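(* For any integer $n\geq 1$, the subgraph of the $(2n+1)$-cube $Q_{2n+1}$ induced by the middle four levels, i.e., by all bitstrings of length $2n+1$ with Hamming weight in the interval $[n-1,n+2]$, has a Hamilton cycle.
   Context: The $n$-cube $Q_n$ is the graph whose vertices are all bitstrings of length $n$, with an edge between any two bitstrings that differ in exactly one bit. The Hamming weight of a bitstring is its number of 1-bits. The $k$th level of $Q_n$ is the set of all bitstrings of length $n$ with Hamming weight exactly $k$. *)

theory Defs
  imports "Graph_Theory.Digraph_Component"
begin

definition hamming_weight :: "bool list \<Rightarrow> nat" where
  "hamming_weight x = card {i. i < length x \<and> x ! i}"

definition hamming_distance :: "bool list \<Rightarrow> bool list \<Rightarrow> nat" where
  "hamming_distance x y = card {i. i < length x \<and> x ! i \<noteq> y ! i}"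

text \<open>As usual in Graph_Theory, an undirected edge is a pair of opposite arcs.\<close>

definition cube :: "nat \<Rightarrow> bool list pair_pre_digraph" where
  "cube n = \<lparr> pverts = {x. length x = n},
     parcs = {(x, y). length x = n \<and> length y = n \<and> hamming_distance x y = 1} \<rparr>"

definition level :: "nat \<Rightarrow> nat \<Rightarrow> bool list set" where
  "level n k = {x \<in> pverts (cube n). hamming_weight x = k}"

text \<open>In a symmetric digraph, \<open>pre_digraph.cycle\<close> also accepts an edge traversed back and
  forth; the bound on the length excludes this. The vertices of a closed walk are the tails
  of its arcs.\<close>

definition hamilton_cycle :: "('a, 'b) pre_digraph \<Rightarrow> 'b awalk \<Rightarrow> bool" where
  "hamilton_cycle G p \<longleftrightarrow>
     pre_digraph.cycle G p \<and> 3 \<le> length p \<and> tail G ` set p = verts G"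

lemma hamming_distance_commute:
  assumes "length x = length y"
  shows "hamming_distance x y = hamming_distance y x"
proof -
  have "{i. i < length x \<and> x ! i \<noteq> y ! i} = {i. i < length y \<and> y ! i \<noteq> x ! i}"
    using assms by auto
  then show ?thesis
    by (simp only: hamming_distance_def)
qed

lemma pair_graph_cube: "pair_graph (cube n)"
proof
  have fin: "finite {x :: bool list. length x = n}"
    using finite_lists_length_eq[of "UNIV :: bool set" n] by simp
  show "finite (pverts (cube n))"
    using fin by (simp add: cube_def)
  have "parcs (cube n) \<subseteq> {x. length x = n} \<times> {y. length y = n}"
    unfolding cube_def by auto
  then show "finite (parcs (cube n))"
    by (rule finite_subset) (rule finite_cartesian_product[OF fin fin])
  have "(y, x) \<in> parcs (cube n)" if "(x, y) \<in> parcs (cube n)" for x y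
    using that hamming_distance_commute[of x y] by (simp add: cube_def)
  then show "symmetric (with_proj (cube n))"
    by (simp add: symmetric_def sym_def)
  fix e assume e: "e \<in> parcs (cube n)"
  obtain x y where xy: "e = (x, y)"
    by (cases e)
  have "length x = n" "length y = n" "hamming_distance x y = 1"
    using e unfolding xy cube_def by simp_all
  moreover have "hamming_distance x x = 0"
    by (simp add: hamming_distance_def)
  ultimately show "fst e \<in> pverts (cube n)" "snd e \<in> pverts (cube n)" "fst e \<noteq> snd e"
    unfolding xy cube_def by auto
qed

end

theory Submission
  imports Defs "HOL-Combinatorics.Permutations"
begin

text \<open>
  The four levels are made into a bipartite graph: the black vertices have weight \<open>n - 1\<close> or
  \<open>n + 1\<close>, the white ones \<open>n\<close> or \<open>n + 2\<close>. Two perfect matchings \<open>to_white\<close> and \<open>to_black\<close>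
  between them, given as bijections from one colour to the other, compose to a permutation
  \<open>\<pi>\<close> of the black vertices whose cycles are the cycles of a 2-factor. It remains to merge these
  cycles into one.

  Merging is done with 4-cycles of the cube. If a 4-cycle has two opposite edges in the matching
  \<open>to_black\<close>, then these can be exchanged for the other two edges; on black vertices this composes
  \<open>\<pi>\<close> with the transposition of the two black vertices of the 4-cycle. If they lie on
  different cycles of \<open>\<pi>\<close>, these cycles merge. A family of disjoint 4-cycles is encoded by
  an involution \<open>partner\<close> on the black vertices. Some of the exchanges turn the 2-factor into
  a Hamilton cycle as soon as \<open>\<pi>\<close> and \<open>partner\<close> together act transitively
  (\<open>cyclic_of_connected\<close>).

  The matchings are described by parsing a bitstring as a sequence of brackets, 1 opening
  and 0 closing. The matched brackets form blocks that are Dyck words, that is, plane forests, and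
  these blocks are separated by unmatched 0s and, further to the right, unmatched 1s. The matching
  \<open>to_black\<close> is the one along the chains of Greene and Kleitman: clear the
  first unmatched 1, or, where there is none, set the unmatched 0. Except on its
  edges between the two middle levels, \<open>to_white\<close> sets the 0 that closes the first tree of the central
  block, between the unmatched 0s and the unmatched 1s, or the last but one unmatched 0 if
  that block is empty. So a step of \<open>\<pi>\<close> is a local operation on forests. Following \<open>\<pi>\<close>,
  the central block is consumed tree by tree (\<open>linked_absorb\<close>). This leads from
  every black vertex to one of the form \<open>u 1 v\<close> with two Dyck words \<open>u\<close> and \<open>v\<close>.

  On these pairs \<open>(u, v)\<close>, the 4-cycles identify \<open>(u, 1 v 0 w)\<close> with \<open>(1 u 0 v, w)\<close>,
  so that the second component can be emptied, and the walks through the lower two levels become a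
  relation between forests (\<open>similar_nest\<close>). By this relation a forest that is not a path
  can be replaced with one that has a longer leftmost path (\<open>similar_deepen\<close>). Hence all of them
  are equivalent to the path, which is the required transitivity.
\<close>

section \<open>Merging the cycles of a permutation\<close>

lemma funpow_return:
  assumes "f permutes X" "finite X"
  obtains k where "k > 0" "(f ^^ k) x = x"
proof -
  have "permutation f"
    using assms permutation_permutes by blast
  then show thesis
    using permutation_self[of f x] that by blast
qed

lemma funpow_reach_trans:
  "\<exists>k. (f ^^ k) x = y \<Longrightarrow> \<exists>k. (f ^^ k) y = z \<Longrightarrow> \<exists>k. (f ^^ k) x = z"
  by (metis comp_apply funpow_add)

lemma funpow_reach_sym:
  assumes "f permutes X" "finite X" "(f ^^ k) x = y"
  shows "\<exists>j. (f ^^ j) y = x"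
proof -
  obtain m where m: "m > 0" "(f ^^ m) x = x"
    using funpow_return[OF assms(1,2)] by blast
  have period: "(f ^^ (m * i)) x = x" for i
    by (induction i) (simp_all add: funpow_add m(2))
  have "(f ^^ (m * k - k)) y = (f ^^ (m * k - k + k)) x"
    using assms(3) by (simp add: funpow_add)
  also have "m * k - k + k = m * k"
    using m(1) by (simp add: Suc_leI)
  finally show ?thesis
    using period by metis
qed

text \<open>Walking along \<open>g\<close> from \<open>a\<close> agrees with walking along \<open>f\<close> until the last vertex of the old
  cycle, from which \<open>g\<close> jumps to \<open>d\<close> instead of returning to \<open>a\<close>. So \<open>a\<close> and \<open>d\<close> are on one
  cycle of \<open>g\<close>, and a step of \<open>f\<close> into \<open>a\<close> or \<open>d\<close> can be replaced with a step of \<open>g\<close> into the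
  other one of them and a walk between them.\<close>

lemma merge_orbits:
  assumes f: "f permutes X" "finite X"
    and ad: "a \<in> X" "d \<in> X" "\<nexists>k. (f ^^ k) a = d"
  defines "g \<equiv> transpose a d \<circ> f"
  shows "g permutes X" "\<exists>k. (g ^^ k) a = d"
    "\<And>x y. \<exists>k. (f ^^ k) x = y \<Longrightarrow> \<exists>k. (g ^^ k) x = y"
proof -
  show g: "g permutes X"
    unfolding g_def using f ad by (intro permutes_compose permutes_swap_id) auto
  define k where "k = (LEAST k. k > 0 \<and> (f ^^ k) a = a)"
  have k: "k > 0" "(f ^^ k) a = a"
    unfolding k_def using funpow_return[OF f, of a] by (smt (verit, best) LeastI)+
  have least: "(f ^^ j) a \<noteq> a" if "0 < j" "j < k" for j
    using that not_less_Least[of j "\<lambda>k. k > 0 \<and> (f ^^ k) a = a"] unfolding k_def by blast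
  have same: "(g ^^ j) a = (f ^^ j) a" if "j < k" for j
    using that
  proof (induction j)
    case (Suc j)
    have "(f ^^ Suc j) a \<noteq> a" "(f ^^ Suc j) a \<noteq> d"
      using least[of "Suc j"] Suc.prems ad(3) by blast+
    then show ?case
      using Suc by (simp add: g_def transpose_def)
  qed simp
  obtain j where j: "k = Suc j"
    using k(1) gr0_conv_Suc by blast
  have "(g ^^ k) a = transpose a d ((f ^^ k) a)"
    using same[of j] by (simp add: j g_def)
  then show ad': "\<exists>k. (g ^^ k) a = d"
    using k(2) by auto
  then have da: "\<exists>k. (g ^^ k) d = a"
    using funpow_reach_sym[OF g f(2)] by blast
  have one: "\<exists>k. (g ^^ k) x = f x" for x
  proof -
    have gx: "\<exists>k. (g ^^ k) x = transpose a d (f x)"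
      by (rule exI[of _ 1]) (simp add: g_def)
    consider "f x = a" | "f x = d" | "f x \<noteq> a" "f x \<noteq> d"
      by blast
    then show ?thesis
    proof cases
      case 1 then show ?thesis using funpow_reach_trans[OF _ da] gx by simp
    next
      case 2 then show ?thesis using funpow_reach_trans[OF _ ad'] gx by simp
    next
      case 3 then show ?thesis using gx by simp
    qed
  qed
  show "\<exists>k. (g ^^ k) x = y" if reach: "\<exists>k. (f ^^ k) x = y" for x y
  proof -
    obtain i where "(f ^^ i) x = y"
      using reach by blast
    moreover have "\<exists>k. (g ^^ k) x = (f ^^ i) x" for i
      by (induction i) (auto intro: exI[of _ 0] funpow_reach_trans[OF _ one])
    ultimately show ?thesis
      by metis
  qed
qed

text \<open>The pairs of \<open>Y\<close> are treated one after the other, and a transposition is used only if the two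
  points are still on different cycles. Since the pairs are disjoint, a point is moved at most
  once, which keeps \<open>g x\<close> equal to \<open>f x\<close> or its partner; the induction needs to record that
  only pairs meeting \<open>Y\<close> have been used.\<close>

lemma merge_along_involution:
  assumes f: "f permutes X" "finite X"
    and p: "\<And>x. x \<in> X \<Longrightarrow> p x \<in> X" "\<And>x. x \<in> X \<Longrightarrow> p (p x) = x"
    and Y: "Y \<subseteq> X"
  shows "\<exists>g. g permutes X \<and>
    (\<forall>x\<in>X. g x = f x \<or> g x = p (f x) \<and> (f x \<in> Y \<or> p (f x) \<in> Y)) \<and>
    (\<forall>x y. (\<exists>k. (f ^^ k) x = y) \<longrightarrow> (\<exists>k. (g ^^ k) x = y)) \<and>
    (\<forall>y\<in>Y. \<exists>k. (g ^^ k) y = p y)"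
  using finite_subset[OF Y f(2)] Y
proof (induction Y rule: finite_induct)
  case empty
  then show ?case
    using f by auto
next
  case (insert a Y)
  then obtain g where g: "g permutes X"
    and gf: "\<And>x. x \<in> X \<Longrightarrow> g x = f x \<or> g x = p (f x) \<and> (f x \<in> Y \<or> p (f x) \<in> Y)"
    and mono: "\<And>x y. \<exists>k. (f ^^ k) x = y \<Longrightarrow> \<exists>k. (g ^^ k) x = y"
    and gp: "\<And>y. y \<in> Y \<Longrightarrow> \<exists>k. (g ^^ k) y = p y"
    by (metis insert_subset)
  have a: "a \<in> X" "p a \<in> X" "p (p a) = a"
    using insert.prems p by auto
  show ?case
  proof (cases "\<exists>k. (g ^^ k) a = p a")
    case True
    then show ?thesis
      using g gf mono gp by (intro exI[of _ g] conjI ballI allI impI) blast+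
  next
    case False
    \<comment> \<open>A pair that was treated earlier is already on one cycle.\<close>
    have notin: "a \<notin> Y" "p a \<notin> Y"
      using False gp[of a] gp[of "p a"] funpow_reach_sym[OF g f(2)] a(3) by metis+
    define h where "h = transpose a (p a) \<circ> g"
    note merged = merge_orbits[OF g f(2) a(1,2) False, folded h_def]
    have "h x = f x \<or> h x = p (f x) \<and> (f x \<in> insert a Y \<or> p (f x) \<in> insert a Y)"
      if x: "x \<in> X" for x
    proof -
      have fx: "f x \<in> X"
        using f(1) x by (simp add: permutes_in_image)
      consider "g x = a" | "g x = p a" | "g x \<noteq> a" "g x \<noteq> p a"
        by blast
      then show ?thesis
      proof cases
        case 1
        have "f x = a"
          using gf[OF x] 1 notin p(2)[OF fx] by metis
        then show ?thesis
          using 1 by (simp add: h_def)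
      next
        case 2
        have "f x = p a"
          using gf[OF x] 2 notin p(2)[OF fx] a(3) by metis
        then show ?thesis
          using 2 a(3) by (simp add: h_def)
      next
        case 3
        then show ?thesis
          using gf[OF x] by (auto simp: h_def transpose_def)
      qed
    qed
    moreover have "\<exists>k. (h ^^ k) y = p y" if "y \<in> insert a Y" for y
      using merged(2) merged(3)[OF gp] insertE[OF that] by metis
    ultimately show ?thesis
      using merged(1) merged(3)[OF mono] by (intro exI[of _ h] conjI ballI allI impI)
  qed
qed

lemma cyclic_of_connected:
  assumes f: "f permutes X" "finite X"
    and p: "\<And>x. x \<in> X \<Longrightarrow> p x \<in> X" "\<And>x. x \<in> X \<Longrightarrow> p (p x) = x"
    and conn: "\<And>x. x \<in> X \<Longrightarrow> equivclp (\<lambda>x y. x \<in> X \<and> (y = f x \<or> y = p x)) x z"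
    and z: "z \<in> X"
  shows "\<exists>g. g permutes X \<and> (\<forall>x\<in>X. g x = f x \<or> g x = p (f x)) \<and>
    (\<forall>x\<in>X. \<exists>k. (g ^^ k) z = x)"
proof -
  obtain g where g: "g permutes X" "\<And>x. x \<in> X \<Longrightarrow> g x = f x \<or> g x = p (f x)"
    and mono: "\<And>x y. \<exists>k. (f ^^ k) x = y \<Longrightarrow> \<exists>k. (g ^^ k) x = y"
    and gp: "\<And>y. y \<in> X \<Longrightarrow> \<exists>k. (g ^^ k) y = p y"
    using merge_along_involution[OF f p order_refl] by blast
  have one: "\<exists>k. (g ^^ k) x = y" if "x \<in> X" "y = f x \<or> y = p x" for x y
    using that gp[of x] mono[of x "f x"] exI[of "\<lambda>k. (f ^^ k) x = f x" 1] by auto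
  have "\<exists>k. (g ^^ k) x = y" if "equivclp (\<lambda>x y. x \<in> X \<and> (y = f x \<or> y = p x)) x y" for x y
    using that
  proof (induction rule: equivclp_induct)
    case base
    then show ?case by (intro exI[of _ 0]) simp
  next
    case (step y z)
    have "\<exists>k. (g ^^ k) y = z"
      using step.hyps(2)
    proof
      assume "y \<in> X \<and> (z = f y \<or> z = p y)"
      then show ?thesis
        by (intro one) auto
    next
      assume "z \<in> X \<and> (y = f z \<or> y = p z)"
      then have "\<exists>k. (g ^^ k) z = y"
        by (intro one) auto
      then show ?thesis
        using funpow_reach_sym[OF g(1) f(2)] by blast
    qed
    with step.IH show ?case
      by (rule funpow_reach_trans)
  qed
  then have "\<exists>k. (g ^^ k) x = z" if "x \<in> X" for x
    using conn[OF that] by blast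
  then have "\<exists>k. (g ^^ k) z = x" if "x \<in> X" for x
    using funpow_reach_sym[OF g(1) f(2)] that by metis
  with g show ?thesis
    by (intro exI[of _ g] conjI ballI)
qed

section \<open>Hamilton cycles from cyclic permutations\<close>

lemma cas_map_arcs:
  assumes "i \<le> k"
  shows "pre_digraph.cas (with_proj G) (v i) (map (\<lambda>i. (v i, v (Suc i))) [i..<k]) (v k)"
    and "pre_digraph.awalk_verts (with_proj G) (v i) (map (\<lambda>i. (v i, v (Suc i))) [i..<k])
      = map v [i..<Suc k]"
  using assms
proof (induction rule: inc_induct)
  case base
  { case 1 show ?case by (simp add: pre_digraph.cas.simps) }
  { case 2 show ?case by (simp add: pre_digraph.awalk_verts.simps) }
next
  case (step i)
  { case 1 show ?case using step by (simp add: upt_conv_Cons pre_digraph.cas.simps) }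
  { case 2 show ?case using step 
      by (simp add: upt_conv_Cons pre_digraph.awalk_verts.simps del: upt_Suc) }
qed

lemma hamilton_cycle_of_closed_sequence:
  assumes inj: "inj_on v {..<k}" and k: "3 \<le> k" and closed: "v k = v 0"
    and verts: "v ` {..<k} = S"
    and arcs: "\<And>i. i < k \<Longrightarrow> (v i, v (Suc i)) \<in> parcs G"
  shows "\<exists>p. hamilton_cycle (with_proj G \<restriction> S) p"
proof -
  let ?H = "with_proj G \<restriction> S"
  define p where "p = map (\<lambda>i. (v i, v (Suc i))) [0..<k]"
  have H: "pre_digraph.cas ?H = pre_digraph.cas (with_proj G)"
    "pre_digraph.awalk_verts ?H = pre_digraph.awalk_verts (with_proj G)"
  proof -
    have "pre_digraph.cas ?H u q w = pre_digraph.cas (with_proj G) u q w" for u q w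
      by (induction q arbitrary: u) (simp_all add: pre_digraph.cas.simps)
    then show "pre_digraph.cas ?H = pre_digraph.cas (with_proj G)"
      by blast
    have "pre_digraph.awalk_verts ?H u q = pre_digraph.awalk_verts (with_proj G) u q" for u q
      by (induction q arbitrary: u) (simp_all add: pre_digraph.awalk_verts.simps)
    then show "pre_digraph.awalk_verts ?H = pre_digraph.awalk_verts (with_proj G)"
      by blast
  qed
  have in_S: "v i \<in> S" if "i \<le> k" for i
    using that verts closed k by (cases "i = k") auto
  have "pre_digraph.awalk ?H (v 0) p (v 0)"
    using cas_map_arcs(1)[of 0 k G v] arcs in_S closed
    by (auto simp: pre_digraph.awalk_def H p_def)
  moreover have "distinct (tl (pre_digraph.awalk_verts ?H (v 0) p))"
  proof -
    have "inj_on v {1..k}"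
    proof (rule inj_onI)
      fix i j assume ij: "i \<in> {1..k}" "j \<in> {1..k}" "v i = v j"
      then have "v (i mod k) = v (j mod k)"
        using closed by (cases "i = k"; cases "j = k") auto
      then have "i mod k = j mod k"
        using inj k by (auto dest: inj_onD)
      then show "i = j"
        using ij k by (cases "i = k"; cases "j = k") auto
    qed
    moreover have "tl (pre_digraph.awalk_verts ?H (v 0) p) = map v [1..<Suc k]"
      using cas_map_arcs(2)[of 0 k G v]
      by (simp add: H p_def map_tl[symmetric] del: upt_Suc)
    ultimately show ?thesis
      by (simp add: distinct_map atLeastLessThanSuc_atLeastAtMost del: upt_Suc)
  qed
  moreover have "tail ?H ` set p = S"
    using verts by (auto simp: p_def image_image lessThan_atLeast0)
  ultimately have "hamilton_cycle ?H p"
    using k by (auto simp: hamilton_cycle_def pre_digraph.cycle_def p_def)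
  then show ?thesis
    by blast
qed

text \<open>The cycle alternates between the two colours: \<open>z, h z, g z, h (g z), g (g z), \<dots>\<close>. The map \<open>b\<close>
  only names the vertices of the graph, which allows to take other objects for them.\<close>

lemma hamilton_cycle_of_cyclic_permutation:
  assumes g: "g permutes X" "finite X" and z: "z \<in> X" "\<And>x. x \<in> X \<Longrightarrow> \<exists>k. (g ^^ k) z = x"
    and h: "bij_betw h X Y" and b: "inj_on b (X \<union> Y)" and disj: "X \<inter> Y = {}"
    and card: "2 \<le> card X"
    and arcs: "\<And>x. x \<in> X \<Longrightarrow> (b x, b (h x)) \<in> parcs G" "\<And>x. x \<in> X \<Longrightarrow> (b (h x), b (g x)) \<in> parcs G"
  shows "\<exists>p. hamilton_cycle (with_proj G \<restriction> b ` (X \<union> Y)) p"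
proof -
  define c where "c = (LEAST k. k > 0 \<and> (g ^^ k) z = z)"
  have c: "c > 0" "(g ^^ c) z = z"
    unfolding c_def using funpow_return[OF g, of z] by (smt (verit, best) LeastI)+
  have least: "(g ^^ j) z \<noteq> z" if "0 < j" "j < c" for j
    using that not_less_Least[of j "\<lambda>k. k > 0 \<and> (g ^^ k) z = z"] unfolding c_def by blast
  have "inj g"
    using g(1) by (rule permutes_inj)
  have inj_c: "i = j" if "(g ^^ i) z = (g ^^ j) z" "i \<le> j" "j < c" for i j
  proof (rule ccontr)
    assume "i \<noteq> j"
    have "(g ^^ i) ((g ^^ (j - i)) z) = (g ^^ i) z"
      using that by (simp flip: funpow_add[THEN fun_cong, unfolded o_apply])
    then have "(g ^^ (j - i)) z = z"
      using inj_fn[OF \<open>inj g\<close>, of i] by (auto dest: injD)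
    then show False
      using least[of "j - i"] that \<open>i \<noteq> j\<close> by simp
  qed
  have inj_z: "inj_on (\<lambda>i. (g ^^ i) z) {..<c}"
    by (rule inj_onI) (metis inj_c lessThan_iff nat_le_linear)
  have in_X: "(g ^^ i) z \<in> X" for i
    using permutes_in_funpow_image[OF g(1) z(1)] .
  have mod_c: "(g ^^ (i mod c)) z = (g ^^ i) z" for i
    using funpow_mod_eq[OF c(2)] by simp
  have X: "(\<lambda>i. (g ^^ i) z) ` {..<c} = X"
  proof
    show "X \<subseteq> (\<lambda>i. (g ^^ i) z) ` {..<c}"
    proof
      fix x assume "x \<in> X"
      then obtain i where "(g ^^ (i mod c)) z = x"
        using z(2) mod_c by metis
      then show "x \<in> (\<lambda>i. (g ^^ i) z) ` {..<c}"
        using c(1) by force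
    qed
  qed (use in_X in auto)
  define v where "v i = b (if even i then (g ^^ (i div 2)) z else h ((g ^^ (i div 2)) z))" for i
  have h_Y: "h x \<in> Y" if "x \<in> X" for x
    using h that by (auto simp: bij_betw_def)
  have inner: "(if even i then (g ^^ (i div 2)) z else h ((g ^^ (i div 2)) z)) \<in> X \<union> Y" for i
    using in_X h_Y by simp
  show ?thesis
  proof (rule hamilton_cycle_of_closed_sequence[of v "2 * c"])
    show "inj_on v {..<2 * c}"
    proof (rule inj_onI)
      fix i j assume ij: "i \<in> {..<2 * c}" "j \<in> {..<2 * c}" "v i = v j"
      have eq: "(if even i then (g ^^ (i div 2)) z else h ((g ^^ (i div 2)) z))
          = (if even j then (g ^^ (j div 2)) z else h ((g ^^ (j div 2)) z))"
        using inj_onD[OF b _ inner inner] ij(3) unfolding v_def by blast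
      have par: "even i = even j"
        using eq in_X h_Y disj by (metis disjoint_iff)
      have "(g ^^ (i div 2)) z = (g ^^ (j div 2)) z"
        using eq par in_X h by (auto simp: bij_betw_def dest: inj_onD split: if_splits)
      then have "i div 2 = j div 2"
        using inj_z ij(1,2) by (auto dest!: inj_onD)
      then show "i = j"
        using par by (metis bit_eq_rec)
    qed
    have "c = card X"
      using card_image[OF inj_z] X by simp
    then show "3 \<le> 2 * c"
      using card by simp
    show "v (2 * c) = v 0"
      using c(2) by (simp add: v_def)
    have "v ` {..<2 * c} = b ` ((\<lambda>i. (g ^^ i) z) ` {..<c} \<union> h ` (\<lambda>i. (g ^^ i) z) ` {..<c})"
    proof (intro equalityI subsetI)
      fix y assume "y \<in> v ` {..<2 * c}"
      then obtain i where "i < 2 * c" "y = v i"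
        by blast
      then show "y \<in> b ` ((\<lambda>i. (g ^^ i) z) ` {..<c} \<union> h ` (\<lambda>i. (g ^^ i) z) ` {..<c})"
        by (auto simp: v_def)
    next
      fix y assume "y \<in> b ` ((\<lambda>i. (g ^^ i) z) ` {..<c} \<union> h ` (\<lambda>i. (g ^^ i) z) ` {..<c})"
      then obtain i where "i < c" "y = b ((g ^^ i) z) \<or> y = b (h ((g ^^ i) z))"
        by blast
      then have "y = v (2 * i) \<or> y = v (Suc (2 * i))" "2 * i < 2 * c" "Suc (2 * i) < 2 * c"
        by (auto simp: v_def)
      then show "y \<in> v ` {..<2 * c}"
        by blast
    qed
    then show "v ` {..<2 * c} = b ` (X \<union> Y)"
      using X h by (simp add: bij_betw_def)
    fix i
    show "(v i, v (Suc i)) \<in> parcs G"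
      using arcs[OF in_X[of "i div 2"]] by (auto simp: v_def elim!: oddE)
  qed
qed

section \<open>Bitstrings as forests separated by unmatched bits\<close>

datatype tree = Node (children: "tree list")

fun dyck :: "tree list \<Rightarrow> bool list" where
  "dyck [] = []"
| "dyck (Node u # v) = True # dyck u @ False # dyck v"

lemma dyck_append [simp]: "dyck (u @ v) = dyck u @ dyck v"
  by (induction u rule: dyck.induct) simp_all

text \<open>In \<open>(ls, d, rs)\<close> each forest of \<open>ls\<close> is followed by an unmatched 0 and each forest of \<open>rs\<close> is
  preceded by an unmatched 1. The list \<open>ls\<close> is reversed, so that its head, like that of \<open>rs\<close>,
  is next to the central block \<open>d\<close>: the matchings act there.\<close>

type_synonym parse = "tree list list \<times> tree list \<times> tree list list"

fun bits :: "parse \<Rightarrow> bool list" where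
  "bits (ls, d, rs) = concat (map (\<lambda>u. dyck u @ [False]) (rev ls)) @ dyck d
     @ concat (map (\<lambda>u. True # dyck u) rs)"

text \<open>Reading a 0 closes the last unmatched 1, if there is one, and makes the block
  after it a tree of the block before it.\<close>

fun parse_bit :: "parse \<Rightarrow> bool \<Rightarrow> parse" where
  "parse_bit (ls, d, rs) b = (if b then (ls, d, rs @ [[]])
     else case rev rs of
       [] \<Rightarrow> (d # ls, [], [])
     | [r] \<Rightarrow> (ls, d @ [Node r], [])
     | r # q # rs' \<Rightarrow> (ls, d, rev rs' @ [q @ [Node r]]))"

lemma bits_parse_bit: "bits (parse_bit s b) = bits s @ [b]"
proof (cases s)
  case (fields ls d rs)
  show ?thesis
  proof (cases rs rule: rev_cases)
    case (snoc rs' r)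
    then show ?thesis
      using fields by (cases rs' rule: rev_cases) auto
  qed (use fields in auto)
qed

lemma bits_foldl: "bits (foldl parse_bit s x) = bits s @ x"
  by (induction x arbitrary: s) (simp_all add: bits_parse_bit del: bits.simps)

lemma parse_dyck:
  "foldl parse_bit (ls, d, []) (dyck u) = (ls, d @ u, [])"
  "foldl parse_bit (ls, d, rs @ [r]) (dyck u) = (ls, d, rs @ [r @ u])"
proof -
  have "foldl parse_bit (ls, d, []) (dyck u) = (ls, d @ u, []) \<and>
    (\<forall>rs r. foldl parse_bit (ls, d, rs @ [r]) (dyck u) = (ls, d, rs @ [r @ u]))"
  proof (induction u arbitrary: d rule: dyck.induct)
    case (2 u v)
    have "foldl parse_bit (ls, d, [[]]) (dyck u) = (ls, d, [u])" for d
      using 2(1)[of d] by (metis append_Nil)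
    moreover have "foldl parse_bit (ls, d, rs @ [r, []]) (dyck u) = (ls, d, rs @ [r, u])" for d rs r
      using 2(1)[of d] by (metis append.assoc append_Cons append_Nil)
    ultimately show ?case
      using 2(2) by simp
  qed simp
  then show
    "foldl parse_bit (ls, d, []) (dyck u) = (ls, d @ u, [])"
    "foldl parse_bit (ls, d, rs @ [r]) (dyck u) = (ls, d, rs @ [r @ u])"
    by blast+
qed

lemma parse_bits: "foldl parse_bit ([], [], []) (bits s) = s"
proof (cases s)
  case (fields ls d rs)
  have left: "foldl parse_bit ([], [], []) (concat (map (\<lambda>u. dyck u @ [False]) (rev ls))) = (ls, [], [])"
    by (induction ls) (simp_all add: parse_dyck)
  have right: "foldl parse_bit (ls, d, []) (concat (map (\<lambda>u. True # dyck u) rs)) = (ls, d, rs)"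
  proof (induction rs rule: rev_induct)
    case (snoc r rs)
    then show ?case
      using parse_dyck(2)[of ls d rs "[]" r] by simp
  qed simp
  show ?thesis
    using fields left right by (simp add: parse_dyck)
qed

lemma bij_bits: "bij bits"
proof (rule o_bij)
  show "(\<lambda>x. foldl parse_bit ([], [], []) x) \<circ> bits = id"
    using parse_bits by auto
  show "bits \<circ> (\<lambda>x. foldl parse_bit ([], [], []) x) = id"
    using bits_foldl by fastforce
qed

text \<open>On plane trees, whose root has the given list of subtrees, this moves the root along its last
  edge. That is one step of the usual rotation, \<open>u 1 v 0\<close> to \<open>1 u 0 v\<close> on Dyck words.\<close>

fun rotate_tree :: "tree list \<Rightarrow> tree list" where
  "rotate_tree u = (if u = [] then [] else Node (butlast u) # children (last u))"

fun unrotate_tree :: "tree list \<Rightarrow> tree list" where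
  "unrotate_tree [] = []"
| "unrotate_tree (Node u # v) = u @ [Node v]"

declare rotate_tree.simps [simp del]

lemma rotate_tree_simps [simp]:
  "rotate_tree [] = []" "rotate_tree (u @ [Node v]) = Node u # v" "rotate_tree [Node v] = Node [] # v"
  by (simp_all add: rotate_tree.simps)

lemma unrotate_rotate [simp]: "unrotate_tree (rotate_tree u) = u"
proof (cases u rule: rev_cases)
  case (snoc v t)
  then show ?thesis by (cases t) simp
qed simp

lemma rotate_unrotate [simp]: "rotate_tree (unrotate_tree u) = u"
  by (cases u rule: unrotate_tree.cases) simp_all

lemma length_dyck_unrotate [simp]: "length (dyck (unrotate_tree u)) = length (dyck u)"
  by (cases u rule: unrotate_tree.cases) simp_all

lemma length_dyck_rotate [simp]: "length (dyck (rotate_tree u)) = length (dyck u)"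
  by (metis length_dyck_unrotate unrotate_rotate)

text \<open>By \<open>weight_bits\<close> below, the difference of the numbers of unmatched 1s and unmatched 0s determines
  the weight: \<open>1\<close> and \<open>-3\<close> stand for the weights \<open>n + 1\<close> and \<open>n - 1\<close>, and
  \<open>3\<close> and \<open>-1\<close> for \<open>n + 2\<close> and \<open>n\<close>.\<close>

definition black :: "nat \<Rightarrow> parse set" where
  "black n = {(ls, d, rs). length (bits (ls, d, rs)) = 2 * n + 1 \<and>
     (length rs = length ls + 1 \<or> length ls = length rs + 3)}"

definition white :: "nat \<Rightarrow> parse set" where
  "white n = {(ls, d, rs). length (bits (ls, d, rs)) = 2 * n + 1 \<and>
     (length rs = length ls + 3 \<or> length ls = length rs + 1)}"

lemma length_bits: "length (bits (ls, d, rs)) = sum_list (map (\<lambda>u. length (dyck u)) ls) + length ls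
    + length (dyck d) + sum_list (map (\<lambda>u. length (dyck u)) rs) + length rs"
proof -
  have "length (concat (map (\<lambda>u. dyck u @ [False]) (rev ls)))
      = sum_list (map (\<lambda>u. length (dyck u)) ls) + length ls"
    by (induction ls) simp_all
  moreover have "length (concat (map (\<lambda>u. True # dyck u) rs))
      = sum_list (map (\<lambda>u. length (dyck u)) rs) + length rs"
    by (induction rs) simp_all
  ultimately show ?thesis
    by simp
qed

lemma mem_black: "(ls, d, rs) \<in> black n \<longleftrightarrow>
    sum_list (map (\<lambda>u. length (dyck u)) ls) + length ls
    + length (dyck d) + sum_list (map (\<lambda>u. length (dyck u)) rs) + length rs = 2 * n + 1 \<and>
     (length rs = length ls + 1 \<or> length ls = length rs + 3)"
  by (simp add: black_def length_bits del: bits.simps)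

lemma mem_white: "(ls, d, rs) \<in> white n \<longleftrightarrow>
    sum_list (map (\<lambda>u. length (dyck u)) ls) + length ls
    + length (dyck d) + sum_list (map (\<lambda>u. length (dyck u)) rs) + length rs = 2 * n + 1 \<and>
     (length rs = length ls + 3 \<or> length ls = length rs + 1)"
  by (simp add: white_def length_bits del: bits.simps)

lemma hamming_weight_filter: "hamming_weight x = length (filter (\<lambda>b. b) x)"
  by (simp add: hamming_weight_def length_filter_conv_card)

lemma weight_dyck: "2 * hamming_weight (dyck u) = length (dyck u)"
  unfolding hamming_weight_filter by (induction u rule: dyck.induct) simp_all

text \<open>A Dyck word has as many 1s as 0s, so the surplus of 1s is that of the unmatched ones.\<close>

lemma weight_bits: "2 * hamming_weight (bits (ls, d, rs)) + length ls
    = length (bits (ls, d, rs)) + length rs"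
proof -
  have d: "2 * length (filter (\<lambda>b. b) (dyck u)) = length (dyck u)" for u
    using weight_dyck by (simp add: hamming_weight_filter)
  have "2 * length (filter (\<lambda>b. b) (concat (map (\<lambda>u. dyck u @ [False]) (rev ls)))) + length ls
      = length (concat (map (\<lambda>u. dyck u @ [False]) (rev ls)))"
    by (induction ls) (simp_all add: d algebra_simps)
  moreover have "2 * length (filter (\<lambda>b. b) (concat (map (\<lambda>u. True # dyck u) rs)))
      = length (concat (map (\<lambda>u. True # dyck u) rs)) + length rs"
    by (induction rs) (simp_all add: d algebra_simps)
  ultimately show ?thesis
    by (simp add: hamming_weight_filter d algebra_simps)
qed

lemma middle_levels_eq:
  assumes "n \<ge> 1"
  shows "(\<Union>k\<in>{n - 1..n + 2}. level (2 * n + 1) k) = bits ` (black n \<union> white n)"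
proof -
  have iff: "s \<in> black n \<union> white n \<longleftrightarrow>
      length (bits s) = 2 * n + 1 \<and> hamming_weight (bits s) \<in> {n - 1..n + 2}" for s
  proof (cases s)
    case (fields ls d rs)
    have arith: "R = L + 1 \<or> L = R + 3 \<or> R = L + 3 \<or> L = R + 1 \<longleftrightarrow> w \<in> {n - 1..n + 2}"
      if "2 * w + L = 2 * n + 1 + R" for w L R :: nat
      using that assms by (simp only: atLeastAtMost_iff) presburger
    show ?thesis
    proof (cases "length (bits s) = 2 * n + 1")
      case True
      then have "2 * hamming_weight (bits s) + length ls = 2 * n + 1 + length rs"
        using weight_bits[of ls d rs] unfolding fields by simp
      from arith[OF this] True show ?thesis
        unfolding fields black_def white_def by blast
    qed (auto simp: fields black_def white_def simp del: bits.simps)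
  qed
  have "(\<Union>k\<in>{n - 1..n + 2}. level (2 * n + 1) k)
      = {x. length x = 2 * n + 1 \<and> hamming_weight x \<in> {n - 1..n + 2}}"
    by (auto simp: level_def cube_def)
  also have "\<dots> = bits ` (black n \<union> white n)"
  proof (intro equalityI subsetI)
    fix x assume x: "x \<in> {x. length x = 2 * n + 1 \<and> hamming_weight x \<in> {n - 1..n + 2}}"
    obtain s where s: "x = bits s"
      using bij_bits by (metis bij_pointE)
    then show "x \<in> bits ` (black n \<union> white n)"
      using x iff[of s] by blast
  next
    fix x assume "x \<in> bits ` (black n \<union> white n)"
    then obtain s where "x = bits s" "s \<in> black n \<union> white n"
      by blast
    then show "x \<in> {x. length x = 2 * n + 1 \<and> hamming_weight x \<in> {n - 1..n + 2}}"
      using iff[of s] by blast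
  qed
  finally show ?thesis .
qed

lemma finite_black: "finite (black n)"
proof (rule finite_imageD)
  show "inj_on bits (black n)"
    using bij_bits by (auto simp: bij_def intro: inj_on_subset)
  have "bits ` black n \<subseteq> {x. set x \<subseteq> UNIV \<and> length x = 2 * n + 1}"
    by (auto simp: black_def simp del: bits.simps)
  then show "finite (bits ` black n)"
    by (rule finite_subset) (rule finite_lists_length_eq, simp)
qed

section \<open>Two perfect matchings\<close>

text \<open>The first two clauses set a bit: \<open>1 u 0 v\<close> becomes \<open>1 u 1 v\<close>, and \<open>l' 0 l 0\<close> becomes \<open>l' 1 l 0\<close>.
  They lead from weight \<open>n - 1\<close> to \<open>n\<close> and from \<open>n + 1\<close> to \<open>n + 2\<close>. The black vertices with
  neither a tree in the central block nor two unmatched 0s have weight \<open>n + 1\<close> and are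
  matched downwards: they begin with \<open>1 r\<close> or \<open>l 0 1 r\<close>, and the bit that is cleared opens
  the last tree of \<open>r\<close>, which turns \<open>1 u 1 v 0\<close> into \<open>1 u 0 v 0\<close>; if \<open>r\<close> is empty, it is the 1 before it.
  In both cases the new central block is empty and is preceded by the rotated \<open>r\<close> and an unmatched 0.\<close>

fun to_white :: "parse \<Rightarrow> parse" where
  "to_white (ls, Node u # v, rs) = (ls, [], u # v # rs)"
| "to_white (l # l' # ls, [], rs) = (ls, l' @ [Node l], rs)"
| "to_white ([], [], r # rs) = ([rotate_tree r], [], rs)"
| "to_white ([l], [], r # rs) = ([rotate_tree r, l], [], rs)"
| "to_white s = s"

fun from_white :: "parse \<Rightarrow> parse" where
  "from_white (ls, t # d, rs) = (children (last (t # d)) # butlast (t # d) # ls, [], rs)"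
| "from_white (ls, [], u # v # rs) = (ls, Node u # v, rs)"
| "from_white (l # ls, [], rs) = (ls, [], unrotate_tree l # rs)"
| "from_white s = s"

lemma from_white_snoc [simp]: "from_white (ls, d @ [Node l], rs) = (l # d # ls, [], rs)"
proof -
  obtain t e where e: "d @ [Node l] = t # e"
    by (cases "d @ [Node l]") auto
  have "from_white (ls, t # e, rs) = (children (last (t # e)) # butlast (t # e) # ls, [], rs)"
    by (rule from_white.simps(1))
  then show ?thesis
    unfolding e[symmetric] by simp
qed

text \<open>Clearing the first unmatched 1 is a step down along a Greene-Kleitman chain. A white vertex
  without unmatched 1s has weight \<open>n\<close> and a single unmatched 0, and it is the bottom of a chain
  with two vertices; it is matched with the top.\<close>

fun to_black :: "parse \<Rightarrow> parse" where
  "to_black (ls, d, r # rs) = (d # ls, r, rs)"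
| "to_black ([l], d, []) = ([], l, [d])"
| "to_black s = s"

fun from_black :: "parse \<Rightarrow> parse" where
  "from_black (l # ls, d, rs) = (ls, l, d # rs)"
| "from_black ([], d, [r]) = ([d], r, [])"
| "from_black s = s"

text \<open>The bitstrings \<open>u 1 1 v 0 w\<close> and \<open>u 0 1 v 1 w\<close> are opposite in the 4-cycle that arises
  by flipping the two bits after \<open>u\<close> and after \<open>v\<close>. The other two vertices are
  \<open>u 0 1 v 0 w\<close> and \<open>u 1 1 v 1 w\<close>, and \<open>to_black\<close> matches each of them with one of the partners by
  flipping the bit after \<open>u\<close>.\<close>

fun partner :: "parse \<Rightarrow> parse" where
  "partner ([], u, [Node v # w]) = ([u], [], [v, w])"
| "partner ([u], [], [v, w]) = ([], u, [Node v # w])"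
| "partner s = s"

text \<open>The inverse tells the clauses of \<open>to_white\<close> apart: the central block is nonempty only after the
  second one, and otherwise the number of unmatched 1s decides: at least two after
  the first, none after the third, one after the fourth.\<close>

lemma bij_to_white: "bij_betw to_white (black n) (white n)"
proof (rule bij_betw_byWitness[of _ from_white])
  show "\<forall>s\<in>black n. from_white (to_white s) = s"
  proof
    fix s assume "s \<in> black n"
    then show "from_white (to_white s) = s"
      by (cases s rule: to_white.cases) (auto simp: mem_black length_Suc_conv)
  qed
  show "\<forall>s\<in>white n. to_white (from_white s) = s"
  proof
    fix s assume "s \<in> white n"
    then show "to_white (from_white s) = s"
      by (cases s rule: from_white.cases) (auto simp: mem_white length_Suc_conv tree.collapse)
  qed
  show "to_white ` black n \<subseteq> white n"
  proof
    fix t assume "t \<in> to_white ` black n"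
    then obtain s where "s \<in> black n" "t = to_white s"
      by blast
    then show "t \<in> white n"
      by (cases s rule: to_white.cases) (auto simp: mem_black mem_white)
  qed
  show "from_white ` white n \<subseteq> black n"
  proof
    fix t assume "t \<in> from_white ` white n"
    then obtain s where "s \<in> white n" "t = from_white s"
      by blast
    then show "t \<in> black n"
    proof (cases s rule: from_white.cases)
      case (1 ls c d rs)
      obtain d' l where "c # d = d' @ [Node l]"
        by (metis list.distinct(1) rev_exhaust tree.exhaust)
      then show ?thesis
        using 1 \<open>s \<in> white n\<close> \<open>t = from_white s\<close> by (auto simp: mem_black mem_white)
    qed (auto simp: mem_black mem_white)
  qed
qed

lemma from_to_black: "s \<in> white n \<Longrightarrow> from_black (to_black s) = s"
  by (cases s rule: to_black.cases) (auto simp: mem_white)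

lemma bij_to_black: "bij_betw to_black (white n) (black n)"
proof (rule bij_betw_byWitness[of _ from_black])
  show "\<forall>s\<in>white n. from_black (to_black s) = s"
    using from_to_black by blast
  show "\<forall>s\<in>black n. to_black (from_black s) = s"
  proof
    fix s assume "s \<in> black n"
    then show "to_black (from_black s) = s"
      by (cases s rule: from_black.cases) (auto simp: mem_black)
  qed
  show "to_black ` white n \<subseteq> black n"
  proof
    fix t assume "t \<in> to_black ` white n"
    then obtain s where "s \<in> white n" "t = to_black s"
      by blast
    then show "t \<in> black n"
      by (cases s rule: to_black.cases) (auto simp: mem_black mem_white)
  qed
  show "from_black ` black n \<subseteq> white n"
  proof
    fix t assume "t \<in> from_black ` black n"
    then obtain s where "s \<in> black n" "t = from_black s"
      by blast
    then show "t \<in> white n"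
      by (cases s rule: from_black.cases) (auto simp: mem_black mem_white)
  qed
qed

lemma partner_black: "s \<in> black n \<Longrightarrow> partner s \<in> black n"
  by (cases s rule: partner.cases) (auto simp: mem_black)

lemma partner_partner: "partner (partner s) = s"
  by (cases s rule: partner.cases) auto

definition flips :: "bool list \<Rightarrow> bool list \<Rightarrow> bool" where
  "flips x y \<longleftrightarrow> (\<exists>p b q. x = p @ b # q \<and> y = p @ (\<not> b) # q)"

lemma flipsI: "x = p @ b # q \<Longrightarrow> y = p @ (\<not> b) # q \<Longrightarrow> flips x y"
  unfolding flips_def by blast

lemma flips_arc:
  assumes "flips x y" "length x = m"
  shows "(x, y) \<in> parcs (cube m)"
proof -
  obtain p b q where x: "x = p @ b # q" and y: "y = p @ (\<not> b) # q"
    using assms(1) unfolding flips_def by blast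
  have "{i. i < length x \<and> x ! i \<noteq> y ! i} = {length p}"
    unfolding x y by (auto simp: nth_append nth_Cons' split: if_splits)
  then show ?thesis
    using assms(2) x y by (simp add: cube_def hamming_distance_def)
qed

lemma flips_to_white:
  assumes "s \<in> black n"
  shows "flips (bits s) (bits (to_white s))"
  using assms
proof (cases s rule: to_white.cases)
  case (1 ls u v rs)
  then show ?thesis
    by (intro flipsI[of _ "concat (map (\<lambda>u. dyck u @ [False]) (rev ls)) @ True # dyck u" False]) auto
next
  case (2 l l' ls rs)
  then show ?thesis
    by (intro flipsI[of _ "concat (map (\<lambda>u. dyck u @ [False]) (rev ls)) @ dyck l'" False]) auto
next
  case (3 r rs)
  let ?R = "concat (map (\<lambda>u. True # dyck u) rs)"
  show ?thesis
  proof (cases r rule: rev_cases)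
    case Nil
    then show ?thesis
      using 3 by (intro flipsI[of _ "[]" True ?R]) auto
  next
    case (snoc a t)
    then show ?thesis
      using 3 by (cases t) (auto intro!: flipsI[of _ "True # dyck a" True "dyck (children t) @ False # ?R"])
  qed
next
  case (4 l r rs)
  let ?R = "concat (map (\<lambda>u. True # dyck u) rs)"
  show ?thesis
  proof (cases r rule: rev_cases)
    case Nil
    then show ?thesis
      using 4 by (intro flipsI[of _ "dyck l @ [False]" True ?R]) auto
  next
    case (snoc a t)
    then show ?thesis
      using 4 by (cases t)
        (auto intro!: flipsI[of _ "dyck l @ False # True # dyck a" True "dyck (children t) @ False # ?R"])
  qed
qed (auto simp: mem_black)

lemma flips_to_black:
  assumes "s \<in> white n"
  shows "flips (bits s) (bits (to_black s))"
  using assms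
proof (cases s rule: to_black.cases)
  case (1 ls d r rs)
  then show ?thesis
    by (intro flipsI[of _ "concat (map (\<lambda>u. dyck u @ [False]) (rev ls)) @ dyck d" True]) auto
next
  case (2 l d)
  then show ?thesis
    by (intro flipsI[of _ "dyck l" False "dyck d"]) auto
qed (auto simp: mem_white)

text \<open>This makes the exchange possible: a white vertex is adjacent to the partner of its mate as well.\<close>

lemma flips_partner:
  assumes "s \<in> white n"
  shows "flips (bits s) (bits (partner (to_black s)))"
proof -
  define t where "t = to_black s"
  have t: "t \<in> black n" "s = from_black t"
    using assms bij_to_black from_to_black unfolding t_def by (auto simp: bij_betw_def)
  have "flips (bits s) (bits (partner t))"
  proof (cases t rule: partner.cases)
    case (1 u v w)
    then have "s = ([u], Node v # w, [])"
      using t(2) by simp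
    then show ?thesis
      using 1 by (intro flipsI[of _ "dyck u @ False # True # dyck v" False "dyck w"]) auto
  next
    case (2 u v w)
    then have "s = ([], u, [[], v, w])"
      using t(2) by simp
    then show ?thesis
      using 2 by (intro flipsI[of _ "dyck u @ True # True # dyck v" True "dyck w"]) auto
  qed (use flips_to_black[OF assms] t_def in simp_all)
  then show ?thesis
    by (simp add: t_def)
qed

section \<open>Connectedness\<close>

text \<open>It is enough to require that \<open>s\<close> is black: the permutation and the involution map black
  vertices to black vertices, so that no walk leaves them.\<close>

definition linked :: "nat \<Rightarrow> parse \<Rightarrow> parse \<Rightarrow> bool" where
  "linked n = equivclp (\<lambda>s t. s \<in> black n \<and> (t = to_black (to_white s) \<or> t = partner s))"

lemma linked_refl [simp]: "linked n s s"
  by (simp add: linked_def equivclp_def)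

lemma linked_sym: "linked n s t \<Longrightarrow> linked n t s"
  unfolding linked_def by (rule equivclp_sym)

lemma linked_trans [trans]: "linked n s t \<Longrightarrow> linked n t u \<Longrightarrow> linked n s u"
  unfolding linked_def by (rule equivclp_trans)

lemma linked_advance: "s \<in> black n \<Longrightarrow> to_black (to_white s) = t \<Longrightarrow> linked n s t"
  unfolding linked_def by (rule r_into_equivclp) simp

lemma linked_partner: "s \<in> black n \<Longrightarrow> partner s = t \<Longrightarrow> linked n s t"
  unfolding linked_def by (rule r_into_equivclp) simp

text \<open>In terms of bitstrings, \<open>l 0 u 1\<close> becomes \<open>l u 0 1\<close>. For \<open>u = 1 x 0 y\<close>, a step of the permutation
  opens the first tree, giving \<open>l 0 0 x 1 y 1\<close>; the inner \<open>0 x 1\<close> becomes \<open>x 0 1\<close>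
  by induction; the next step closes the tree again to the left of the unmatched 0,
  giving \<open>l 1 x 0 0 y 1\<close>, and \<open>y\<close> is moved by induction.\<close>

lemma linked_absorb:
  assumes "(l # ls, u, rs) \<in> black n"
  shows "linked n (l # ls, u, rs) ((l @ u) # ls, [], rs)"
  using assms
proof (induction u arbitrary: l ls rs rule: dyck.induct)
  case (2 u v)
  have "linked n (l # ls, Node u # v, rs) ([] # l # ls, u, v # rs)"
    using 2 by (intro linked_advance) auto
  also have "linked n \<dots> (u # l # ls, [], v # rs)"
    using 2(1)[of "[]" "l # ls" "v # rs"] 2(3) by (simp add: mem_black)
  also have "linked n \<dots> ((l @ [Node u]) # ls, v, rs)"
    using 2(3) by (intro linked_advance) (auto simp: mem_black)
  also have "linked n \<dots> ((l @ Node u # v) # ls, [], rs)"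
    using 2(2)[of "l @ [Node u]" ls rs] 2(3) by (simp add: mem_black)
  finally show ?case .
qed simp

text \<open>Here the walk goes through the lower two levels and back: from weight \<open>n + 1\<close> down
  to \<open>n - 1\<close>, where it absorbs \<open>b\<close>, and up again by the second clause of \<open>to_black\<close>.\<close>

lemma linked_cross:
  assumes "([u], [], [a, b]) \<in> black n"
  shows "linked n ([u], [], [a, b]) ([], u, [rotate_tree a @ [Node b]])"
proof -
  have "linked n ([u], [], [a, b]) ([[], rotate_tree a, u], b, [])"
    using assms by (intro linked_advance) auto
  also have "linked n \<dots> ([b, rotate_tree a, u], [], [])"
    using linked_absorb[of "[]" "[rotate_tree a, u]" b "[]"] assms by (simp add: mem_black)
  also have "linked n \<dots> ([], u, [rotate_tree a @ [Node b]])"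
    using assms by (intro linked_advance) (auto simp: mem_black)
  finally show ?thesis .
qed

text \<open>Absorbing empties the central block, and the next step removes an unmatched 0.\<close>

lemma linked_to_one_unmatched:
  assumes "s \<in> black n"
  obtains a b where "length (dyck a) + length (dyck b) = 2 * n" "linked n s ([], a, [b])"
proof -
  have "\<exists>a b. length (dyck a) + length (dyck b) = 2 * n \<and> linked n (ls, d, rs) ([], a, [b])"
    if "(ls, d, rs) \<in> black n" for ls d rs
    using that
  proof (induction "length ls" arbitrary: ls d rs rule: less_induct)
    case less
    show ?case
    proof (cases ls)
      case Nil
      then obtain b where "rs = [b]"
        using less.prems by (auto simp: mem_black length_Suc_conv)
      then have "length (dyck d) + length (dyck b) = 2 * n \<and> linked n (ls, d, rs) ([], d, [b])"
        using Nil less.prems by (simp add: mem_black)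
      then show ?thesis
        by blast
    next
      case (Cons l ls')
      define k where "k = l @ d"
      have start: "linked n (ls, d, rs) (k # ls', [], rs)"
        using linked_absorb less.prems unfolding Cons k_def by blast
      have k: "(k # ls', [], rs) \<in> black n"
        using less.prems unfolding Cons k_def by (simp add: mem_black)
      show ?thesis
      proof (cases ls')
        case Nil
        then obtain a b where "rs = [a, b]"
          using k by (auto simp: mem_black length_Suc_conv)
        have "linked n (ls, d, [a, b]) ([], k, [rotate_tree a @ [Node b]])"
          using k unfolding Nil \<open>rs = [a, b]\<close>
          by (intro linked_trans[OF start[unfolded Nil \<open>rs = [a, b]\<close>]] linked_cross)
        moreover have "length (dyck k) + length (dyck (rotate_tree a @ [Node b])) = 2 * n"
          using k Nil \<open>rs = [a, b]\<close> by (simp add: mem_black)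
        ultimately show ?thesis
          unfolding \<open>rs = [a, b]\<close> by blast
      next
        case ls': (Cons l' ls'')
        show ?thesis
        proof (cases rs)
          case Nil
          then obtain l'' where l'': "ls'' = [l'']"
            using k ls' by (auto simp: mem_black length_Suc_conv)
          have "linked n (k # ls', [], rs) ([], l'', [l' @ [Node k]])"
            using k unfolding ls' l'' Nil by (intro linked_advance) auto
          then have "linked n (ls, d, rs) ([], l'', [l' @ [Node k]])"
            by (rule linked_trans[OF start])
          moreover have "length (dyck l'') + length (dyck (l' @ [Node k])) = 2 * n"
            using k ls' l'' Nil by (simp add: mem_black)
          ultimately show ?thesis
            by blast
        next
          case rs: (Cons r rs')
          have less': "((l' @ [Node k]) # ls'', r, rs') \<in> black n"
            using k unfolding ls' rs by (simp add: mem_black)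
          have "linked n (k # ls', [], rs) ((l' @ [Node k]) # ls'', r, rs')"
            using k unfolding ls' rs by (intro linked_advance) auto
          with start have "linked n (ls, d, rs) ((l' @ [Node k]) # ls'', r, rs')"
            by (rule linked_trans)
          from linked_trans[OF this] show ?thesis
            using less.hyps[OF _ less'] Cons ls' by fastforce
        qed
      qed
    qed
  qed
  then show thesis
    using that assms by (cases s) blast
qed

text \<open>Since \<open>u 0 1 v 1 b\<close> also lies on the walk that starts at \<open>1 u 0 v 1 b\<close>, the 4-cycles allow to move
  the first tree of one side of the unmatched 1 to the other.\<close>

lemma linked_square:
  assumes "length (dyck (Node u # v)) + length (dyck b) = 2 * n"
  shows "linked n ([], u, [Node v # b]) ([u], [], [v, b])"
    "linked n ([], Node u # v, [b]) ([u], [], [v, b])"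
proof -
  show "linked n ([], u, [Node v # b]) ([u], [], [v, b])"
    using assms by (intro linked_partner) (auto simp: mem_black)
  have "linked n ([], Node u # v, [b]) ([[]], u, [v, b])"
    using assms by (intro linked_advance) (auto simp: mem_black)
  also have "linked n \<dots> ([u], [], [v, b])"
    using linked_absorb[of "[]" "[]" u "[v, b]"] assms by (simp add: mem_black)
  finally show "linked n ([], Node u # v, [b]) ([u], [], [v, b])" .
qed

text \<open>The first component that results when \<open>linked_square\<close> is used, as long as possible, to move trees
  from the right to the left of the unmatched 1.\<close>

fun nest :: "tree list \<Rightarrow> tree list \<Rightarrow> tree list" where
  "nest a [] = a"
| "nest a (Node v # z) = nest (Node a # v) z"

lemma nest_append: "nest a (x @ y) = nest (nest a x) y"
  by (induction a x rule: nest.induct) simp_all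

lemma length_dyck_nest [simp]: "length (dyck (nest a b)) = length (dyck a) + length (dyck b)"
  by (induction a b rule: nest.induct) simp_all

lemma linked_nest:
  assumes "length (dyck a) + length (dyck b) = 2 * n"
  shows "linked n ([], a, [b]) ([], nest a b, [[]])"
  using assms
proof (induction a b rule: nest.induct)
  case (2 a v z)
  have len: "length (dyck (Node a # v)) + length (dyck z) = 2 * n"
    using 2(2) by simp
  have "linked n ([], a, [Node v # z]) ([a], [], [v, z])"
    by (rule linked_square(1)[OF len])
  also have "linked n \<dots> ([], Node a # v, [z])"
    by (rule linked_sym, rule linked_square(2)[OF len])
  also have "linked n \<dots> ([], nest (Node a # v) z, [[]])"
    by (rule 2(1)[OF len])
  finally show ?case
    by simp
qed simp

text \<open>Equivalence of the forests \<open>u\<close> that stand for the vertices \<open>u 1\<close>.\<close>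

definition similar :: "nat \<Rightarrow> tree list \<Rightarrow> tree list \<Rightarrow> bool" where
  "similar n a b = linked n ([], a, [[]]) ([], b, [[]])"

lemma similar_trans [trans]: "similar n a b \<Longrightarrow> similar n b c \<Longrightarrow> similar n a c"
  unfolding similar_def by (rule linked_trans)

text \<open>Both sides come from \<open>a 0 1 v 1 z\<close>: the walk along the permutation ends at
  \<open>a 1 (rotate_tree v) 1 z 0\<close>, the 4-cycle leads to \<open>a 1 1 v 0 z\<close>, and in both the trees on the right are
  then moved to the left.\<close>

lemma similar_nest:
  assumes "length (dyck (Node a # v)) + length (dyck z) = 2 * n"
  shows "similar n (Node (nest a (rotate_tree v)) # z) (nest (Node a # v) z)"
proof -
  have "linked n ([], a, [rotate_tree v @ [Node z]]) ([], Node (nest a (rotate_tree v)) # z, [[]])"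
    using linked_nest[of a "rotate_tree v @ [Node z]" n] assms by (simp add: nest_append)
  then have "linked n ([], Node (nest a (rotate_tree v)) # z, [[]]) ([], a, [rotate_tree v @ [Node z]])"
    by (rule linked_sym)
  also have "linked n \<dots> ([a], [], [v, z])"
    by (rule linked_sym, rule linked_cross) (use assms in \<open>simp add: mem_black\<close>)
  also have "linked n \<dots> ([], a, [Node v # z])"
    by (rule linked_sym, rule linked_square(1)[OF assms])
  also have "linked n \<dots> ([], nest (Node a # v) z, [[]])"
    using linked_nest[of a "Node v # z" n] assms by simp
  finally show ?thesis
    unfolding similar_def .
qed

text \<open>The forest \<open>u\<close> below a path with \<open>i\<close> edges.\<close>

definition tower :: "nat \<Rightarrow> tree list \<Rightarrow> tree list" where
  "tower i u = ((\<lambda>u. [Node u]) ^^ i) u"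

lemma tower_simps [simp]: "tower 0 u = u" "tower (Suc i) u = [Node (tower i u)]"
  by (simp_all add: tower_def)

lemma tower_shift: "tower i [Node u] = tower (Suc i) u"
  by (induction i) simp_all

lemma length_dyck_tower [simp]: "length (dyck (tower i u)) = 2 * i + length (dyck u)"
  by (induction i) simp_all

lemma nest_leaves: "nest a (replicate i (Node [])) = tower i a"
  by (induction i arbitrary: a) (simp_all add: tower_shift)

lemma length_dyck_leaves [simp]: "length (dyck (replicate i (Node []))) = 2 * i"
  by (induction i) simp_all

text \<open>Without a tower this is the case \<open>v = []\<close> of \<open>similar_nest\<close>. To apply it below a tower, the
  tower is first taken apart: as nesting \<open>j\<close> leaves builds a tower, \<open>similar_nest\<close> read
  backwards turns a tower of height \<open>j + 1\<close> into an additional last tree of the forest, whose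
  root has \<open>j\<close> leaves as children. Two further applications deepen the forest and rebuild the
  tower from these leaves.\<close>

lemma similar_deepen:
  assumes "length (dyck (tower i (Node u # v))) = 2 * n"
  shows "similar n (tower i (Node u # v)) (tower i (nest [Node u] v))"
proof (cases i)
  case 0
  then show ?thesis
    using similar_nest[of u "[]" v n] assms by simp
next
  case (Suc j)
  let ?t = "replicate j (Node [])"
  \<comment> \<open>The inverse rotation produces the forest \<open>v @ [Node ?t]\<close> whose rotation, nested into \<open>u\<close>,
    rebuilds the given tower.\<close>
  have "similar n [Node (nest u (Node v # ?t))] (Node u # v @ [Node ?t])"
    using similar_nest[of u "unrotate_tree (Node v # ?t)" "[]" n] assms Suc by simp
  then have "similar n (tower i (Node u # v)) (Node u # v @ [Node ?t])"
    by (simp add: Suc nest_leaves)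
  also have "similar n \<dots> (Node (nest [Node u] v) # ?t)"
    using similar_nest[of u "[]" "v @ [Node ?t]" n] assms Suc by (simp add: nest_append)
  also have "similar n \<dots> (tower i (nest [Node u] v))"
    using similar_nest[of "nest [Node u] v" "[]" ?t n] assms Suc
    by (simp add: nest_leaves tower_shift)
  finally show ?thesis .
qed

text \<open>The length of the leftmost path.\<close>

fun spine :: "tree list \<Rightarrow> nat" where
  "spine [] = 0"
| "spine (Node u # v) = Suc (spine u)"

lemma spine_le: "2 * spine u \<le> length (dyck u)"
  by (induction u rule: spine.induct) simp_all

lemma spine_nest: "spine (nest a b) = length b + spine a"
  by (induction a b rule: nest.induct) simp_all

lemma spine_tower: "spine (tower i u) = i + spine u"
  by (induction i) simp_all

text \<open>Descend while there is only one tree.\<close>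

lemma tower_cases:
  obtains i where "u = tower i []"
  | i v t w where "u = tower i (Node v # t # w)"
proof -
  have "(\<exists>i. u = tower i []) \<or> (\<exists>i v t w. u = tower i (Node v # t # w))"
  proof (induction u rule: spine.induct)
    case 1
    have "[] = tower 0 []"
      by simp
    then show ?case
      by blast
  next
    case (2 u v)
    show ?case
    proof (cases v)
      case Nil
      then have "Node u # v = tower (Suc i) w" if "u = tower i w" for i w
        using that by simp
      then show ?thesis
        using 2 by blast
    next
      case (Cons t w)
      then have "Node u # v = tower 0 (Node u # t # w)"
        by simp
      then show ?thesis
        by blast
    qed
  qed
  then show thesis
    using that by blast
qed

text \<open>Nesting a nonempty \<open>t # w\<close> lengthens the leftmost path by the number of trees in it, and this
  path has at most \<open>n\<close> edges.\<close>

lemma similar_tower: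
  assumes "length (dyck u) = 2 * n"
  shows "similar n u (tower n [])"
  using assms
proof (induction "n - spine u" arbitrary: u rule: less_induct)
  case less
  show ?case
  proof (cases u rule: tower_cases)
    case (1 i)
    then show ?thesis
      using less.prems by (simp add: similar_def)
  next
    case (2 i v t w)
    let ?u' = "tower i (nest [Node v] (t # w))"
    have "spine ?u' > spine u"
      by (simp add: 2 spine_tower spine_nest)
    moreover have len: "length (dyck ?u') = 2 * n"
      using less.prems unfolding 2 by (cases t) simp
    then have "spine ?u' \<le> n"
      using spine_le[of ?u'] by simp
    ultimately have "n - spine ?u' < n - spine u"
      by linarith
    then have "similar n ?u' (tower n [])"
      using less.hyps len by blast
    moreover have "similar n u ?u'"
      using similar_deepen less.prems unfolding 2 by blast
    ultimately show ?thesis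
      using similar_trans[of n u ?u'] by blast
  qed
qed

lemma linked_tower:
  assumes "s \<in> black n"
  shows "linked n s ([], tower n [], [[]])"
proof -
  obtain a b where ab: "length (dyck a) + length (dyck b) = 2 * n" "linked n s ([], a, [b])"
    using linked_to_one_unmatched[OF assms] by blast
  note ab(2)
  also have "linked n ([], a, [b]) ([], nest a b, [[]])"
    by (rule linked_nest[OF ab(1)])
  also have "linked n \<dots> ([], tower n [], [[]])"
    using similar_tower[of "nest a b" n] ab(1) by (simp add: similar_def)
  finally show ?thesis .
qed

section \<open>The Hamilton cycle\<close>

theorem theorem1:
  fixes n :: nat
  assumes "n \<ge> 1"
  shows "\<exists>p. hamilton_cycle
    (with_proj (cube (2 * n + 1)) \<restriction> (\<Union>k\<in>{n - 1..n + 2}. level (2 * n + 1) k)) p"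
proof -
  define f where "f s = (if s \<in> black n then to_black (to_white s) else s)" for s
  let ?z = "([], tower n [], [[]]) :: parse"
  have "bij_betw (to_black \<circ> to_white) (black n) (black n)"
    using bij_to_white bij_to_black by (rule bij_betw_trans)
  then have "bij_betw f (black n) (black n)"
    by (rule bij_betw_cong[THEN iffD1, rotated]) (simp add: f_def)
  then have f: "f permutes black n"
    by (rule bij_imp_permutes) (simp add: f_def)
  have z: "?z \<in> black n"
    by (simp add: mem_black)
  have conn: "equivclp (\<lambda>s t. s \<in> black n \<and> (t = f s \<or> t = partner s)) s ?z" if "s \<in> black n" for s
  proof -
    have "(\<lambda>s t. s \<in> black n \<and> (t = to_black (to_white s) \<or> t = partner s))
        = (\<lambda>s t. s \<in> black n \<and> (t = f s \<or> t = partner s))"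
      by (auto simp: f_def fun_eq_iff)
    then show ?thesis
      using linked_tower[OF that] by (simp add: linked_def)
  qed
  have "\<exists>g. g permutes black n \<and> (\<forall>s\<in>black n. g s = f s \<or> g s = partner (f s)) \<and>
      (\<forall>s\<in>black n. \<exists>k. (g ^^ k) ?z = s)"
    by (rule cyclic_of_connected[OF f finite_black partner_black partner_partner conn z])
  then obtain g where g: "g permutes black n"
    and g_cases: "\<forall>s\<in>black n. g s = f s \<or> g s = partner (f s)"
    and cyclic: "\<forall>s\<in>black n. \<exists>k. (g ^^ k) ?z = s"
    by (elim exE conjE)
  have white: "to_white s \<in> white n" if "s \<in> black n" for s
    using bij_to_white that by (auto simp: bij_betw_def)
  have "\<exists>p. hamilton_cycle (with_proj (cube (2 * n + 1)) \<restriction> bits ` (black n \<union> white n)) p"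
  proof (rule hamilton_cycle_of_cyclic_permutation[OF g finite_black z bspec[OF cyclic] bij_to_white])
    show "inj_on bits (black n \<union> white n)"
      using bij_bits by (auto simp: bij_def intro: inj_on_subset)
    show "black n \<inter> white n = {}"
      by (auto simp: black_def white_def)
    \<comment> \<open>These two black vertices would coincide for \<open>n = 0\<close>, where the cycle degenerates to one edge.\<close>
    have "card {?z, ([], [], [tower n []])} \<le> card (black n)"
      by (rule card_mono[OF finite_black]) (simp add: mem_black)
    then show "2 \<le> card (black n)"
      using assms by (cases n) simp_all
    fix s assume s: "s \<in> black n"
    show "(bits s, bits (to_white s)) \<in> parcs (cube (2 * n + 1))"
      using flips_to_white[OF s] s by (intro flips_arc) (auto simp: black_def simp del: bits.simps)
    have "flips (bits (to_white s)) (bits (g s))"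
      using bspec[OF g_cases s] s flips_to_black[OF white[OF s]] flips_partner[OF white[OF s]]
      by (auto simp: f_def)
    then show "(bits (to_white s), bits (g s)) \<in> parcs (cube (2 * n + 1))"
      using white[OF s] by (intro flips_arc) (auto simp: white_def simp del: bits.simps)
  qed
  then show ?thesis
    by (simp only: middle_levels_eq[OF assms])
qed

end
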